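(* Let $G=(V,D,B)$ be a mixed graph on $n$ vertices. If $G$ is simple, then the map $$\phi_G:\mathbb{R}^D_{\mathrm{reg}}\times PD(B)\to PD_V,\qquad (\Lambda,\Omega)\mapsto (I-\Lambda)^{-T}\,\Omega\,(I-\Lambda)^{-1}$$ is generically finite-to-one.
   Context: A mixed graph $G=(V,D,B)$ has vertex set $V=[n]=\{1,\dots,n\}$, a set $D$ of directed edges $(i,j)$ with $i\ne j$ (directed cycles are allowed), and a set $B$ of bidirected edges $i\leftrightarrow j$ with $i\neq j$. $G$ is simple if there is at most one edge (directed or bidirected) between any two vertices $i\neq j$; in particular $(i,j)$ and $(j,i)$ are not both in $D$. $\mathbb{R}^D$ is the set of matrices $\Lambda=(\lambda_{ij})\in\mathbb{R}^{n\times n}$ with $\lambda_{ij}\neq 0$ if and only if $(i,j)\in D$; $\mathbb{R}^D_{\mathrm{reg}}$ is the set of $\Lambda\in\mathbb{R}^D$ such that $I-\Lambda$ is invertible. $PD_V$ is the cone of symmetric positive definite real $n\times n$ matrices, and $PD(B)$ is the set of $\Omega=(\omega_{ij})\in PD_V$ with $\omega_{ij}=0$ whenever $i\ne j$ and $i\leftrightarrow j\notin B$. $A^{-T}$ denotes $(A^{-1})^T$. The domain $\mathbb{R}^D_{\mathrm{reg}}\times PD(B)$ is identified with an open subset of $\mathbb{R}^{|D|+|V|+|B|}$ via the coordinates $\lambda_{ij}$ ($(i,j)\in D$), $\omega_{ii}$ ($i\in V$) and $\omega_{ij}$ ($i\leftrightarrow j\in B$). The map $\phi_G$ is generically finite-to-one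 if $\phi_G$ is locally injective at almost all (with respect to Lebesgue measure) $(\Lambda,\Omega)\in\mathbb{R}^D_{\mathrm{reg}}\times PD(B)$, i.e. almost every point of the domain has a neighbourhood on which $\phi_G$ is injective. *)

theory Defs
  imports "HOL-Analysis.Analysis"
begin

text \<open>
  The vertex set is an arbitrary finite type, so \<open>n = CARD('n)\<close>.  Directed edges are ordered pairs;
  a bidirected edge between \<open>i\<close> and \<open>j\<close> is the unordered pair \<open>{i, j}\<close>, so that it
  contributes a single coordinate below.
\<close>

definition mixed_graph :: "('n \<times> 'n) set \<Rightarrow> 'n set set \<Rightarrow> bool" where
  "mixed_graph D B \<longleftrightarrow>
     (\<forall>i j. (i, j) \<in> D \<longrightarrow> i \<noteq> j) \<and> (\<forall>e\<in>B. \<exists>i j. i \<noteq> j \<and> e = {i, j})"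

definition simple_mixed_graph :: "('n \<times> 'n) set \<Rightarrow> 'n set set \<Rightarrow> bool" where
  "simple_mixed_graph D B \<longleftrightarrow>
     (\<forall>i j. i \<noteq> j \<longrightarrow> card (D \<inter> {(i, j), (j, i)}) + card (B \<inter> {{i, j}}) \<le> 1)"

definition RD :: "('n::finite \<times> 'n) set \<Rightarrow> (real^'n^'n) set" where
  "RD D = {L. \<forall>i j. L $ i $ j \<noteq> 0 \<longleftrightarrow> (i, j) \<in> D}"

definition RD_reg :: "('n::finite \<times> 'n) set \<Rightarrow> (real^'n^'n) set" where
  "RD_reg D = {L \<in> RD D. invertible (mat 1 - L)}"

definition PD :: "(real^'n^'n) set" where
  "PD = {A. transpose A = A \<and> (\<forall>x. x \<noteq> 0 \<longrightarrow> x \<bullet> (A *v x) > 0)}"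

definition PD_on :: "'n::finite set set \<Rightarrow> (real^'n^'n) set" where
  "PD_on B = {W \<in> PD. \<forall>i j. i \<noteq> j \<and> {i, j} \<notin> B \<longrightarrow> W $ i $ j = 0}"

definition params :: "('n::finite \<times> 'n) set \<Rightarrow> 'n set set \<Rightarrow> ((real^'n^'n) \<times> (real^'n^'n)) set" where
  "params D B = RD_reg D \<times> PD_on B"

definition phi :: "(real^'n^'n) \<times> (real^'n^'n) \<Rightarrow> real^'n^'n" where
  "phi = (\<lambda>(L, W). transpose (matrix_inv (mat 1 - L)) ** W ** matrix_inv (mat 1 - L))"

lemma phi_in_PD: "phi \<in> params D B \<rightarrow> PD"
proof
  fix p assume "p \<in> params D B"
  then obtain L W where p: "p = (L, W)" and inv: "invertible (mat 1 - L)" and W: "W \<in> PD"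
    by (auto simp: params_def RD_reg_def PD_on_def)
  define M where "M = matrix_inv (mat 1 - L)"
  have M: "(mat 1 - L) ** M = mat 1"
    unfolding M_def matrix_inv_def using inv someI_ex[of "\<lambda>A'. (mat 1 - L) ** A' = mat 1 \<and> A' ** (mat 1 - L) = mat 1"]
    by (auto simp: invertible_def)
  have phi: "phi p = transpose M ** W ** M"
    by (simp add: phi_def p M_def)
  have "transpose (phi p) = phi p"
    using W by (simp add: phi PD_def matrix_transpose_mul matrix_mul_assoc)
  moreover have "x \<bullet> (phi p *v x) > 0" if "x \<noteq> 0" for x
  proof -
    have "(mat 1 - L) *v (M *v x) = x"
      by (simp add: matrix_vector_mul_assoc M)
    hence "M *v x \<noteq> 0"
      using that by (metis matrix_vector_mult_0_right)
    hence "(M *v x) \<bullet> (W *v (M *v x)) > 0"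
      using W by (simp add: PD_def)
    also have "(M *v x) \<bullet> (W *v (M *v x)) = x \<bullet> (transpose M *v (W *v (M *v x)))"
      by (metis dot_lmul_matrix transpose_matrix_vector transpose_transpose)
    finally show ?thesis
      by (simp add: phi matrix_vector_mul_assoc matrix_mul_assoc)
  qed
  ultimately show "phi p \<in> PD"
    by (simp add: PD_def)
qed

text \<open>
  The coordinates \<open>\<lambda>\<^sub>i\<^sub>j\<close> for \<open>(i, j) \<in> D\<close>, \<open>\<omega>\<^sub>i\<^sub>i\<close> for all \<open>i\<close>, and \<open>\<omega>\<^sub>i\<^sub>j\<close> for
  \<open>{i, j} \<in> B\<close>.
\<close>

datatype 'n coord = Lam "'n \<times> 'n" | Diag 'n | Offdiag "'n set"

definition coords :: "('n \<times> 'n) set \<Rightarrow> 'n set set \<Rightarrow> 'n coord set" where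
  "coords D B = Lam ` D \<union> range Diag \<union> Offdiag ` B"

definition of_coords ::
  "('n::finite \<times> 'n) set \<Rightarrow> 'n set set \<Rightarrow> ('n coord \<Rightarrow> real) \<Rightarrow> (real^'n^'n) \<times> (real^'n^'n)" where
  "of_coords D B x =
     (\<chi> i j. if (i, j) \<in> D then x (Lam (i, j)) else 0,
      \<chi> i j. if i = j then x (Diag i) else if {i, j} \<in> B then x (Offdiag {i, j}) else 0)"

lemma card_coords:
  fixes D :: "('n::finite \<times> 'n) set"
  shows "card (coords D B) = card D + CARD('n) + card B"
proof -
  have "card (Lam ` D \<union> range Diag \<union> Offdiag ` B)
      = card (Lam ` D) + card (range (Diag :: 'n \<Rightarrow> 'n coord)) + card (Offdiag ` B)"
    by (subst card_Un_disjoint; (subst card_Un_disjoint)?) auto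
  thus ?thesis
    by (simp add: coords_def card_image inj_on_def)
qed

lemma bij_betw_of_coords:
  assumes "mixed_graph D B"
  shows "bij_betw (of_coords D B)
           {x \<in> PiE (coords D B) (\<lambda>_. UNIV). of_coords D B x \<in> params D B} (params D B)"
  unfolding bij_betw_def
proof (intro conjI)
  show "inj_on (of_coords D B) {x \<in> PiE (coords D B) (\<lambda>_. UNIV). of_coords D B x \<in> params D B}"
  proof (rule inj_onI)
    fix x y
    assume xy: "x \<in> {x \<in> PiE (coords D B) (\<lambda>_. UNIV). of_coords D B x \<in> params D B}"
      "y \<in> {x \<in> PiE (coords D B) (\<lambda>_. UNIV). of_coords D B x \<in> params D B}"
      and eq: "of_coords D B x = of_coords D B y"
    from eq have L: "\<And>i j. (if (i, j) \<in> D then x (Lam (i, j)) else 0)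
                         = (if (i, j) \<in> D then y (Lam (i, j)) else 0)"
      and W: "\<And>i j. (if i = j then x (Diag i) else if {i, j} \<in> B then x (Offdiag {i, j}) else 0)
            = (if i = j then y (Diag i) else if {i, j} \<in> B then y (Offdiag {i, j}) else 0)"
      by (simp_all add: of_coords_def vec_eq_iff)
    show "x = y"
    proof (rule PiE_ext)
      show "x \<in> PiE (coords D B) (\<lambda>_. UNIV)" "y \<in> PiE (coords D B) (\<lambda>_. UNIV)"
        using xy by simp_all
      fix c assume "c \<in> coords D B"
      then consider i j where "c = Lam (i, j)" "(i, j) \<in> D" | i where "c = Diag i"
        | e where "c = Offdiag e" "e \<in> B"
        by (auto simp: coords_def)
      thus "x c = y c"
      proof cases
        case (1 i j) thus ?thesis using L[of i j] by simp
      next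
        case (2 i) thus ?thesis using W[of i i] by simp
      next
        case (3 e)
        then obtain i j where "i \<noteq> j" "e = {i, j}"
          using assms by (auto simp: mixed_graph_def)
        thus ?thesis using 3 W[of i j] by simp
      qed
    qed
  qed
  show "of_coords D B ` {x \<in> PiE (coords D B) (\<lambda>_. UNIV). of_coords D B x \<in> params D B} = params D B"
  proof (intro equalityI subsetI)
    fix p assume p: "p \<in> params D B"
    obtain L W where LW: "p = (L, W)" by fastforce
    have sym: "W $ i $ j = W $ j $ i" for i j
      using p LW by (auto simp: params_def PD_on_def PD_def transpose_def vec_eq_iff)
    define w where "w e = (SOME r. \<exists>i j. e = {i, j} \<and> r = W $ i $ j)" for e
    have w: "w {i, j} = W $ i $ j" for i j
      unfolding w_def by (rule some_equality) (auto simp: doubleton_eq_iff sym)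
    define x where "x = restrict
      (\<lambda>c. case c of Lam e \<Rightarrow> L $ fst e $ snd e | Diag i \<Rightarrow> W $ i $ i | Offdiag e \<Rightarrow> w e) (coords D B)"
    have "x \<in> PiE (coords D B) (\<lambda>_. UNIV)"
      by (simp add: x_def)
    moreover have "of_coords D B x = p"
      using p by (auto simp: of_coords_def x_def LW vec_eq_iff coords_def w params_def RD_reg_def
          RD_def PD_on_def)
    ultimately show
      "p \<in> of_coords D B ` {x \<in> PiE (coords D B) (\<lambda>_. UNIV). of_coords D B x \<in> params D B}"
      using p by (intro image_eqI[of _ _ x]) auto
  qed auto
qed

definition locally_injective_at ::
  "('a::topological_space \<Rightarrow> 'b) \<Rightarrow> 'a set \<Rightarrow> 'a \<Rightarrow> bool" where
  "locally_injective_at f S p \<longleftrightarrow>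
     (\<exists>U. openin (top_of_set S) U \<and> p \<in> U \<and> inj_on f U)"

text \<open>
  Lebesgue measure on the coordinate space is the product of the Borel--Lebesgue measures on the
  axes; completing it would not change which properties hold almost everywhere.
\<close>

definition generically_finite_to_one ::
  "('n::finite \<times> 'n) set \<Rightarrow> 'n set set \<Rightarrow> ((real^'n^'n) \<times> (real^'n^'n) \<Rightarrow> 'b) \<Rightarrow> bool" where
  "generically_finite_to_one D B f \<longleftrightarrow>
     (AE x in PiM (coords D B) (\<lambda>_. lborel).
        of_coords D B x \<in> params D B \<longrightarrow> locally_injective_at f (params D B) (of_coords D B x))"

end

theory Submission
  imports Defs
begin

text \<open>
  Write \<open>A = I - \<Lambda>\<close>, \<open>A' = I - \<Lambda>'\<close> and suppose that both parameters have the same image \<open>\<Sigma>\<close>, so that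
  \<open>A\<^sup>T \<Sigma> A = \<Omega>\<close> and \<open>A'\<^sup>T \<Sigma> A' = \<Omega>'\<close>.  Polarisation gives \<open>X E + (X E)\<^sup>T = 2 (\<Omega> - \<Omega>')\<close> for
  \<open>X = (A + A')\<^sup>T \<Sigma>\<close> and \<open>E = A - A'\<close>, and simplicity makes the right-hand side vanish on \<open>D\<close>.
  This is a homogeneous square linear system for the entries of \<open>E\<close> on \<open>D\<close>.  Its matrix depends
  continuously on both parameters, so \<open>\<phi>\<close> is locally injective wherever the determinant of the
  system is nonzero on the diagonal, where \<open>X = 2 \<Omega> A\<^sup>-\<^sup>1\<close>.  After multiplication of \<open>X\<close> by \<open>det A / 2\<close>
  that determinant is a polynomial in the coordinates; it takes the value 1 at \<open>\<Lambda> = 0\<close>, \<open>\<Omega> = I\<close>,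
  because \<open>D\<close> never contains both \<open>(i, j)\<close> and \<open>(j, i)\<close>, and hence is nonzero almost everywhere.
\<close>

section \<open>Polynomial functions on the coordinate space and their zero sets\<close>

inductive coord_polynomial :: "'a set \<Rightarrow> (('a \<Rightarrow> real) \<Rightarrow> real) \<Rightarrow> bool" for I where
  const: "coord_polynomial I (\<lambda>_. a)"
| component: "i \<in> I \<Longrightarrow> coord_polynomial I (\<lambda>x. x i)"
| add: "coord_polynomial I f \<Longrightarrow> coord_polynomial I g \<Longrightarrow> coord_polynomial I (\<lambda>x. f x + g x)"
| mult: "coord_polynomial I f \<Longrightarrow> coord_polynomial I g \<Longrightarrow> coord_polynomial I (\<lambda>x. f x * g x)"

lemma coord_polynomial_diff:
  assumes "coord_polynomial I f" "coord_polynomial I g"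
  shows "coord_polynomial I (\<lambda>x. f x - g x)"
  using coord_polynomial.add[OF assms(1) coord_polynomial.mult[OF
      coord_polynomial.const[of I "-1"] assms(2)]] by simp

lemma coord_polynomial_sum:
  "(\<And>k. k \<in> K \<Longrightarrow> coord_polynomial I (f k)) \<Longrightarrow> coord_polynomial I (\<lambda>x. \<Sum>k\<in>K. f k x)"
  by (induction K rule: infinite_finite_induct) (auto intro: coord_polynomial.intros)

lemma coord_polynomial_prod:
  "(\<And>k. k \<in> K \<Longrightarrow> coord_polynomial I (f k)) \<Longrightarrow> coord_polynomial I (\<lambda>x. \<Prod>k\<in>K. f k x)"
  by (induction K rule: infinite_finite_induct) (auto intro: coord_polynomial.intros)

lemma coord_polynomial_measurable:
  assumes "coord_polynomial I f"
  shows "f \<in> borel_measurable (Pi\<^sub>M I (\<lambda>_. lborel))"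
  using assms
proof induction
  case (component i)
  show ?case using measurable_component_singleton[OF component, of "\<lambda>_. lborel"] by simp
qed auto

text \<open>Freezing one variable reduces the number of variables, as the induction behind
  \<open>AE_coord_polynomial_nonzero\<close> requires.\<close>

lemma coord_polynomial_fun_upd:
  assumes "coord_polynomial (insert i I) f"
  shows "coord_polynomial I (\<lambda>x. f (x(i := a)))"
  using assms
proof induction
  case (component j)
  then show ?case by (cases "j = i") (auto intro: coord_polynomial.intros)
qed (auto intro: coord_polynomial.intros)

lemma coord_polynomial_line:
  assumes "coord_polynomial I f"
  shows "\<exists>p. \<forall>t. f (x(i := t)) = poly p t"
  using assms
proof induction
  case (const a)
  show ?case by (rule exI[of _ "[:a:]"]) simp
next
  case (component j)
  show ?case
  proof (cases "j = i")
    case True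
    then show ?thesis by (intro exI[of _ "[:0, 1:]"]) simp
  next
    case False
    then show ?thesis by (intro exI[of _ "[:x j:]"]) simp
  qed
next
  case (add f g)
  then show ?case by (metis poly_add)
next
  case (mult f g)
  then show ?case by (metis poly_mult)
qed

lemma coord_polynomial_empty:
  assumes "coord_polynomial {} f"
  shows "f x = f y"
  using assms by induction auto

lemma AE_coord_polynomial_nonzero:
  assumes "finite I" "coord_polynomial I f" "f a \<noteq> 0"
  shows "AE x in Pi\<^sub>M I (\<lambda>_. lborel). f x \<noteq> 0"
  using assms
proof (induction I arbitrary: f rule: finite_induct)
  case empty
  then show ?case using coord_polynomial_empty by (metis (mono_tags, lifting) AE_I2)
next
  case (insert i I)
  interpret product_sigma_finite "\<lambda>_ :: 'a. lborel :: real measure" ..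
  let ?Z = "indicator {x. f x = 0} :: ('a \<Rightarrow> real) \<Rightarrow> ennreal"
  note [measurable] = coord_polynomial_measurable[OF insert.prems(1)]
  have Z: "?Z \<in> borel_measurable (Pi\<^sub>M (insert i I) (\<lambda>_. lborel))"
    unfolding indicator_def by measurable
  have "AE x in Pi\<^sub>M I (\<lambda>_. lborel). f (x(i := a i)) \<noteq> 0"
    using insert.prems by (intro insert.IH coord_polynomial_fun_upd) auto
  then have "AE x in Pi\<^sub>M I (\<lambda>_. lborel). (\<integral>\<^sup>+ t. ?Z (x(i := t)) \<partial>lborel) = 0"
  proof eventually_elim
    case (elim x)
    obtain p where p: "f (x(i := t)) = poly p t" for t
      using coord_polynomial_line[OF insert.prems(1)] by blast
    then have "p \<noteq> 0" using elim by auto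
    then have "AE t in lborel. t \<notin> {t. poly p t = 0}"
      by (intro AE_not_in finite_imp_null_set_lborel poly_roots_finite)
    then have "AE t in lborel. ?Z (x(i := t)) = 0"
      by eventually_elim (simp add: p)
    then show ?case by (subst nn_integral_cong_AE[where v = "\<lambda>_. 0"]) auto
  qed
  then have "(\<integral>\<^sup>+ x. (\<integral>\<^sup>+ t. ?Z (x(i := t)) \<partial>lborel) \<partial>Pi\<^sub>M I (\<lambda>_. lborel)) = 0"
    by (subst nn_integral_cong_AE[where v = "\<lambda>_. 0"]) auto
  then have "integral\<^sup>N (Pi\<^sub>M (insert i I) (\<lambda>_. lborel)) ?Z = 0"
    by (subst product_nn_integral_insert[OF insert.hyps Z])
  then have "AE x in Pi\<^sub>M (insert i I) (\<lambda>_. lborel). ?Z x = 0"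
    using nn_integral_0_iff_AE[OF Z] by simp
  then show ?case
    by eventually_elim (simp add: indicator_eq_0_iff)
qed

section \<open>Determinants, adjugates and inverses as polynomial or continuous functions\<close>

lemma coord_polynomial_det:
  assumes "\<And>i j. coord_polynomial I (\<lambda>x. A x $ i $ j)"
  shows "coord_polynomial I (\<lambda>x. det (A x))"
  unfolding det_def
  by (intro coord_polynomial_sum coord_polynomial.mult coord_polynomial.const
      coord_polynomial_prod assms)

lemma continuous_on_det:
  fixes A :: "'a::topological_space \<Rightarrow> real^'n^'n"
  assumes "continuous_on S A"
  shows "continuous_on S (\<lambda>x. det (A x))"
  unfolding det_def by (intro continuous_intros assms)

lemma continuous_on_matrix_mult:
  fixes A :: "'a::topological_space \<Rightarrow> real^'n^'m" and B :: "'a \<Rightarrow> real^'k^'n"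
  assumes "continuous_on S A" "continuous_on S B"
  shows "continuous_on S (\<lambda>x. A x ** B x)"
  unfolding matrix_matrix_mult_def by (intro continuous_intros assms)

lemma continuous_on_transpose:
  fixes A :: "'a::topological_space \<Rightarrow> real^'n^'m"
  assumes "continuous_on S A"
  shows "continuous_on S (\<lambda>x. transpose (A x))"
  unfolding transpose_def by (intro continuous_intros assms)

lemma matrix_inv_right_left:
  assumes "invertible A"
  shows "A ** matrix_inv A = mat 1" "matrix_inv A ** A = mat 1"
  using assms someI_ex[of "\<lambda>A'. A ** A' = mat 1 \<and> A' ** A = mat 1"]
  by (auto simp: invertible_def matrix_inv_def)

text \<open>The classical adjugate in the form of Cramer's rule: column \<open>i\<close> of
  \<open>A\<close> is replaced by the \<open>j\<close>-th unit vector. This makes it visibly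
  polynomial in the entries of \<open>A\<close>.\<close>

definition adjugate :: "real^'n^'n \<Rightarrow> real^'n^'n" where
  "adjugate A = (\<chi> i j. det (\<chi> r s. if s = i then mat 1 $ r $ j else A $ r $ s))"

text \<open>Cramer's rule, applied to each column of the inverse.\<close>

lemma adjugate_eq:
  assumes "invertible A"
  shows "adjugate A = det A *\<^sub>R matrix_inv A"
proof (subst vec_eq_iff, intro allI, subst vec_eq_iff, intro allI)
  fix i j
  have "A *v column j (matrix_inv A) = column j (mat 1)"
    using matrix_inv_right_left(1)[OF assms]
    by (metis matrix_vector_mul_assoc matrix_vector_mult_basis)
  then show "adjugate A $ i $ j = (det A *\<^sub>R matrix_inv A) $ i $ j"
    using cramer_lemma[of i A "column j (matrix_inv A)"]
    by (simp add: adjugate_def column_def mult.commute cong: if_cong)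
qed

text \<open>The inverse is the adjugate divided by the determinant, and both are continuous in the
  entries.\<close>

lemma continuous_on_matrix_inv:
  fixes A :: "'a::topological_space \<Rightarrow> real^'n^'n"
  assumes "continuous_on S A" "\<And>x. x \<in> S \<Longrightarrow> invertible (A x)"
  shows "continuous_on S (\<lambda>x. matrix_inv (A x))"
proof -
  have "continuous_on S (\<lambda>x. if s = i then mat 1 $ r $ j else A x $ r $ s)" for i j r s
    by (cases "s = i") (auto intro!: continuous_intros assms)
  then have "continuous_on S (\<lambda>x. inverse (det (A x)) *\<^sub>R adjugate (A x))"
    unfolding adjugate_def
    by (intro continuous_intros continuous_on_det assms) (simp add: assms flip: invertible_det_nz)
  moreover have "inverse (det (A x)) *\<^sub>R adjugate (A x) = matrix_inv (A x)" if "x \<in> S" for x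
    using assms(2)[OF that] by (simp add: adjugate_eq invertible_det_nz)
  ultimately show ?thesis by (simp cong: continuous_on_cong)
qed

lemma coord_polynomial_matrix_mult:
  assumes "\<And>i j. coord_polynomial I (\<lambda>x. A x $ i $ j)" "\<And>i j. coord_polynomial I (\<lambda>x. C x $ i $ j)"
  shows "coord_polynomial I (\<lambda>x. (A x ** C x) $ i $ j)"
  unfolding matrix_matrix_mult_def
  by (simp, intro coord_polynomial_sum coord_polynomial.mult assms)

lemma coord_polynomial_adjugate:
  assumes "\<And>i j. coord_polynomial I (\<lambda>x. A x $ i $ j)"
  shows "coord_polynomial I (\<lambda>x. adjugate (A x) $ i $ j)"
proof -
  have "coord_polynomial I (\<lambda>x. if s = i then mat 1 $ r $ j else A x $ r $ s)" for r s
    by (cases "s = i") (auto intro!: coord_polynomial.intros assms)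
  then show ?thesis
    unfolding adjugate_def by (simp, intro coord_polynomial_det) simp
qed

section \<open>The linear system for the difference of two parameters\<close>

text \<open>
  The matrix of the linear map sending a matrix \<open>E\<close> supported on \<open>D\<close> to the entries of
  \<open>X E + (X E)\<^sup>T\<close> at the positions in \<open>D\<close>, padded with the identity to all of \<open>'n \<times> 'n\<close>.
\<close>

definition edge_matrix ::
  "('n::finite \<times> 'n) set \<Rightarrow> real^'n^'n \<Rightarrow> real^('n \<times> 'n)^('n \<times> 'n)" where
  "edge_matrix D X = (\<chi> p q. if p \<in> D \<and> q \<in> D
     then (if snd q = snd p then X $ fst p $ fst q else 0)
        + (if snd q = fst p then X $ snd p $ fst q else 0)
     else if p = q then 1 else 0)"

text \<open>For \<open>p\<close> and \<open>q\<close> in \<open>D\<close>, the first summand is 1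
  exactly when \<open>q = p\<close>, the second exactly when \<open>q\<close> is the reversal of
  \<open>p\<close>. The assumption rules out the second case.\<close>

lemma edge_matrix_mat_1:
  assumes "\<And>i j. (i, j) \<in> D \<Longrightarrow> (j, i) \<notin> D"
  shows "edge_matrix D (mat 1) = mat 1"
  by (auto simp: edge_matrix_def mat_def vec_eq_iff dest: assms)

text \<open>In a row from \<open>D\<close>, the columns outside \<open>D\<close> meet zero entries
  of \<open>E\<close>. A row outside \<open>D\<close> is a row of the identity and returns
  \<open>E $ i $ j\<close>, which is 0.\<close>

lemma edge_matrix_mult:
  assumes "\<And>i j. (i, j) \<notin> D \<Longrightarrow> E $ i $ j = 0"
  shows "(edge_matrix D X *v (\<chi> q. E $ fst q $ snd q)) $ (i, j)
    = (if (i, j) \<in> D then (X ** E + transpose (X ** E)) $ i $ j else 0)"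
proof (cases "(i, j) \<in> D")
  case True
  have "(edge_matrix D X *v (\<chi> q. E $ fst q $ snd q)) $ (i, j) =
    (\<Sum>q\<in>UNIV. (if snd q = j then X $ i $ fst q * E $ fst q $ snd q else 0)
        + (if snd q = i then X $ j $ fst q * E $ fst q $ snd q else 0))"
    unfolding matrix_vector_mult_def vec_lambda_beta
    by (intro sum.cong) (use True assms in \<open>auto simp: edge_matrix_def\<close>)
  also have "\<dots> = (\<Sum>k\<in>UNIV. \<Sum>l\<in>UNIV. (if l = j then X $ i $ k * E $ k $ l else 0)
        + (if l = i then X $ j $ k * E $ k $ l else 0))"
    by (simp add: sum.cartesian_product split_def flip: UNIV_Times_UNIV)
  also have "\<dots> = (X ** E + transpose (X ** E)) $ i $ j"
    by (simp add: sum.distrib matrix_matrix_mult_def transpose_def)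
  finally show ?thesis using True by simp
next
  case False
  have "(edge_matrix D X *v (\<chi> q. E $ fst q $ snd q)) $ (i, j) =
    (\<Sum>q\<in>UNIV. if q = (i, j) then E $ fst q $ snd q else 0)"
    unfolding matrix_vector_mult_def vec_lambda_beta
    by (intro sum.cong) (use False in \<open>auto simp: edge_matrix_def\<close>)
  then show ?thesis using False assms by simp
qed

lemma eq_0_if_det_edge_matrix:
  assumes "det (edge_matrix D X) \<noteq> 0"
    and "\<And>i j. (i, j) \<notin> D \<Longrightarrow> E $ i $ j = 0"
    and "\<And>i j. (i, j) \<in> D \<Longrightarrow> (X ** E + transpose (X ** E)) $ i $ j = 0"
  shows "E = 0"
proof -
  let ?e = "\<chi> q. E $ fst q $ snd q"
  have "edge_matrix D X *v ?e = 0"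
    using edge_matrix_mult[OF assms(2)] assms(3) by (auto simp: vec_eq_iff)
  moreover have "invertible (edge_matrix D X)"
    using assms(1) by (simp add: invertible_det_nz)
  ultimately have "?e = 0"
    using matrix_left_invertible_ker invertible_left_inverse by blast
  then show ?thesis by (simp add: vec_eq_iff)
qed

section \<open>Comparing two parameters with the same image\<close>

lemma phi_congruence:
  assumes "invertible (mat 1 - L)"
  shows "transpose (mat 1 - L) ** phi (L, W) ** (mat 1 - L) = W"
proof -
  define A where "A = mat 1 - L"
  have inv: "matrix_inv A ** A = mat 1"
    using matrix_inv_right_left assms by (simp add: A_def)
  have "transpose A ** transpose (matrix_inv A) = mat 1"
    by (simp add: inv flip: matrix_transpose_mul)
  then have "transpose A ** (transpose (matrix_inv A) ** W ** matrix_inv A) ** A = W"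
    using inv by (metis matrix_mul_assoc matrix_mul_lid matrix_mul_rid)
  then show ?thesis by (simp add: phi_def A_def)
qed

lemma matrix_mult_diff:
  fixes A A' :: "real^'n^'m" and C C' :: "real^'k^'n"
  shows "(A + A') ** C = A ** C + A' ** C" "A ** (C - C') = A ** C - A ** C'"
  by (simp_all add: matrix_matrix_mult_def vec_eq_iff algebra_simps sum.distrib sum_subtractf)

text \<open>Since \<open>S\<close> is symmetric, the mixed terms with \<open>A\<close> and
  \<open>A'\<close> are transposes of each other. They enter \<open>P\<close> with opposite signs
  and cancel in \<open>P + transpose P\<close>.\<close>

lemma congruence_difference:
  fixes A A' S :: "real^'n^'n"
  assumes "transpose S = S"
  defines "P \<equiv> transpose (A + A') ** S ** (A - A')"
  shows "P + transpose P = 2 *\<^sub>R (transpose A ** S ** A - transpose A' ** S ** A')"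
proof -
  have P: "P = transpose A ** S ** A + transpose A' ** S ** A
    - transpose A ** S ** A' - transpose A' ** S ** A'"
  proof -
    have "transpose (A + A') = transpose A + transpose A'"
      by (simp add: transpose_def vec_eq_iff)
    then show ?thesis by (simp add: P_def matrix_mult_diff)
  qed
  have "transpose P = transpose A ** S ** A + transpose A ** S ** A'
    - transpose A' ** S ** A - transpose A' ** S ** A'"
  proof -
    have T: "transpose (M + N) = transpose M + transpose N" "transpose (M - N) = transpose M - transpose N"
      for M N :: "real^'n^'n"
      by (simp_all add: transpose_def vec_eq_iff)
    show ?thesis by (simp add: P T matrix_transpose_mul assms(1) matrix_mul_assoc)
  qed
  then show ?thesis using P by (simp add: scaleR_2)
qed

lemma coord_polynomial_det_edge_matrix:
  assumes "\<And>i j. coord_polynomial I (\<lambda>x. X x $ i $ j)"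
  shows "coord_polynomial I (\<lambda>x. det (edge_matrix D (X x)))"
proof (rule coord_polynomial_det)
  fix p q
  have "coord_polynomial I (\<lambda>x. if c then X x $ i $ j else 0)" for c i j
    by (cases c) (auto intro: assms coord_polynomial.const)
  then show "coord_polynomial I (\<lambda>x. edge_matrix D (X x) $ p $ q)"
    by (cases "p \<in> D \<and> q \<in> D") (auto simp: edge_matrix_def intro!: coord_polynomial.intros)
qed

lemma continuous_on_det_edge_matrix:
  fixes X :: "'a::topological_space \<Rightarrow> real^'n^'n"
  assumes "continuous_on S X"
  shows "continuous_on S (\<lambda>x. det (edge_matrix D (X x)))"
proof -
  have "continuous_on S (\<lambda>x. if c then X x $ i $ j else 0)" for c i j
    by (cases c) (auto intro!: continuous_intros assms)
  then have "continuous_on S (\<lambda>x. edge_matrix D (X x) $ p $ q)" for p q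
    by (cases "p \<in> D \<and> q \<in> D") (auto simp: edge_matrix_def intro!: continuous_intros)
  then have "continuous_on S (\<lambda>x. \<chi> p q. edge_matrix D (X x) $ p $ q)"
    by (intro continuous_on_vec_lambda)
  then show ?thesis by (intro continuous_on_det) simp
qed

lemma continuous_on_phi: "continuous_on (params D B) phi"
proof -
  have "continuous_on (params D B) (\<lambda>p. matrix_inv (mat 1 - fst p))"
    by (intro continuous_on_matrix_inv continuous_intros) (auto simp: params_def RD_reg_def)
  then have "continuous_on (params D B)
     (\<lambda>p. transpose (matrix_inv (mat 1 - fst p)) ** snd p ** matrix_inv (mat 1 - fst p))"
    by (intro continuous_on_matrix_mult continuous_on_transpose continuous_intros)
  then show ?thesis by (simp add: phi_def split_def)
qed

lemma simple_mixed_graphD: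
  assumes "mixed_graph D B" "simple_mixed_graph D B" "(i, j) \<in> D"
  shows "i \<noteq> j" "(j, i) \<notin> D" "{i, j} \<notin> B"
proof -
  show ne: "i \<noteq> j" using assms by (auto simp: mixed_graph_def)
  then have le: "card (D \<inter> {(i, j), (j, i)}) + card (B \<inter> {{i, j}}) \<le> 1"
    using assms(2) by (simp add: simple_mixed_graph_def)
  show "(j, i) \<notin> D"
  proof
    assume "(j, i) \<in> D"
    then have "D \<inter> {(i, j), (j, i)} = {(i, j), (j, i)}" using assms by auto
    then show False using le ne by simp
  qed
  then have "D \<inter> {(i, j), (j, i)} = {(i, j)}" using assms by auto
  then show "{i, j} \<notin> B" using le by auto
qed

text \<open>The equations on \<open>D\<close> are homogeneous, so they persist when the coefficient
  matrix is scaled by \<open>c\<close>. A later choice of \<open>c\<close> clears the denominator of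
  the inverse.\<close>

lemma params_eq_if_phi_eq:
  assumes G: "mixed_graph D B" "simple_mixed_graph D B"
    and p: "(L, W) \<in> params D B" "(L', W') \<in> params D B"
    and eq: "phi (L, W) = phi (L', W')"
    and det: "det (edge_matrix D
      (c *\<^sub>R (transpose ((mat 1 - L) + (mat 1 - L')) ** phi (L, W)))) \<noteq> 0"
  shows "(L, W) = (L', W')"
proof -
  define A where "A = mat 1 - L"
  define A' where "A' = mat 1 - L'"
  define S where "S = phi (L, W)"
  let ?P = "transpose (A + A') ** S ** (A - A')"
  have "transpose S = S"
    using phi_in_PD p(1) unfolding S_def PD_def by blast
  moreover have W: "transpose A ** S ** A = W" "transpose A' ** S ** A' = W'"
    using p phi_congruence[of L W] phi_congruence[of L' W'] eq
    by (auto simp: A_def A'_def S_def params_def RD_reg_def)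
  ultimately have P: "?P + transpose ?P = 2 *\<^sub>R (W - W')"
    using congruence_difference[of S A A'] by simp
  have scale: "(c *\<^sub>R transpose (A + A') ** S) ** (A - A') = c *\<^sub>R ?P"
    by (simp add: scalar_matrix_assoc)
  have "A - A' = 0"
  proof (rule eq_0_if_det_edge_matrix)
    show "det (edge_matrix D (c *\<^sub>R transpose (A + A') ** S)) \<noteq> 0"
      using det by (simp add: A_def A'_def S_def scalar_matrix_assoc)
    fix i j
    show "(A - A') $ i $ j = 0" if "(i, j) \<notin> D"
    proof -
      have "L $ i $ j = 0" "L' $ i $ j = 0"
        using p that by (auto simp: params_def RD_reg_def RD_def)
      then show ?thesis by (simp add: A_def A'_def)
    qed
    assume D: "(i, j) \<in> D"
    \<comment> \<open>Simplicity forbids a bidirected edge parallel to \<open>(i, j)\<close>, so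
      \<open>W\<close> and \<open>W'\<close> both vanish at this position.\<close>
    have "(?P + transpose ?P) $ i $ j = 0"
      using p simple_mixed_graphD[OF G D] by (simp add: P params_def PD_on_def)
    then show "(c *\<^sub>R transpose (A + A') ** S ** (A - A')
        + transpose (c *\<^sub>R transpose (A + A') ** S ** (A - A'))) $ i $ j = 0"
      unfolding scale by (simp add: transpose_def flip: distrib_left)
  qed
  \<comment> \<open>With \<open>A = A'\<close>, both \<open>W\<close> and \<open>W'\<close> are the
    same congruence of \<open>S\<close>.\<close>
  then show ?thesis using W by (auto simp: A_def A'_def)
qed

section \<open>Local injectivity, first at one parameter and then almost everywhere\<close>

text \<open>By continuity the determinant stays nonzero for all pairs of parameters close to the
  diagonal point. Any two nearby parameters with equal image therefore coincide.\<close>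

lemma locally_injective_at_phi:
  fixes D :: "('n::finite \<times> 'n) set"
  assumes G: "mixed_graph D B" "simple_mixed_graph D B"
    and p: "(L, W) \<in> params D B"
    and det: "det (edge_matrix D (W ** adjugate (mat 1 - L))) \<noteq> 0"
  shows "locally_injective_at phi (params D B) (L, W)"
proof -
  let ?S = "params D B"
  define A where "A = mat 1 - L"
  \<comment> \<open>The factor \<open>det A\<close> belongs to the fixed base point and is constant
    in \<open>p\<close> and \<open>q\<close>. Together with the 1/2, which undoes the doubling
    \<open>A + A\<close>, it turns \<open>X\<close> at the base pair into
    \<open>W ** adjugate A\<close>.\<close>
  define X :: "((real^'n^'n) \<times> (real^'n^'n)) \<times> ((real^'n^'n) \<times> (real^'n^'n)) \<Rightarrow> real^'n^'n"
    where "X = (\<lambda>(p, q).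
    (det A / 2) *\<^sub>R (transpose ((mat 1 - fst p) + (mat 1 - fst q)) ** phi p))"
  define h where "h r = det (edge_matrix D (X r))" for r
  have inv: "invertible A"
    using p by (simp add: A_def params_def RD_reg_def)
  have "continuous_on (?S \<times> ?S) (\<lambda>r. phi (fst r))"
    by (rule continuous_on_compose2[OF continuous_on_phi]) (auto intro: continuous_intros)
  then have "continuous_on (?S \<times> ?S) h"
    unfolding h_def X_def split_def
    by (intro continuous_on_det_edge_matrix continuous_on_matrix_mult continuous_on_transpose
        continuous_intros)
  then obtain T where T: "open T" "T \<inter> (?S \<times> ?S) = h -` (-{0}) \<inter> (?S \<times> ?S)"
    unfolding continuous_on_open_invariant by (metis open_Compl closed_singleton)
  have "X ((L, W), (L, W)) = W ** adjugate A"
  proof -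
    have "transpose A ** phi (L, W) = W ** matrix_inv A"
      using phi_congruence[of L W] inv matrix_inv_right_left[OF inv]
      by (metis A_def matrix_mul_assoc matrix_mul_rid)
    moreover have "transpose (A + A) = 2 *\<^sub>R transpose A"
      by (simp add: transpose_def vec_eq_iff)
    moreover have "X ((L, W), (L, W)) = (det A / 2) *\<^sub>R (transpose (A + A) ** phi (L, W))"
      by (simp only: X_def A_def prod.case fst_conv)
    ultimately have "X ((L, W), (L, W)) = det A *\<^sub>R (W ** matrix_inv A)"
      by (simp flip: scalar_matrix_assoc)
    then show ?thesis
      by (simp add: adjugate_eq inv matrix_scalar_ac scalar_matrix_assoc)
  qed
  then have "((L, W), (L, W)) \<in> T"
    using T det p by (auto simp: h_def A_def)
  then obtain T1 T2 where T12: "open T1" "open T2" "(L, W) \<in> T1" "(L, W) \<in> T2" "T1 \<times> T2 \<subseteq> T"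
    using open_prod_elim[OF T(1)] by (metis mem_Sigma_iff)
  \<comment> \<open>Intersecting the two sides of the box puts every pair from \<open>?U\<close>
    into \<open>T\<close>.\<close>
  let ?U = "?S \<inter> (T1 \<inter> T2)"
  have "inj_on phi ?U"
  proof (rule inj_onI)
    fix q r assume qr: "q \<in> ?U" "r \<in> ?U" "phi q = phi r"
    then have "h (q, r) \<noteq> 0" using T T12 by blast
    then show "q = r"
      using params_eq_if_phi_eq[OF G, of "fst q" "snd q" "fst r" "snd r" "det A / 2"] qr
      by (simp add: h_def X_def)
  qed
  then show ?thesis
    unfolding locally_injective_at_def using p T12
    by (intro exI[of _ ?U] conjI openin_open_Int) auto
qed

theorem theorem3p5:
  fixes D :: "('n::finite \<times> 'n) set" and B :: "'n set set"
  assumes "mixed_graph D B" and "simple_mixed_graph D B"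
  shows "generically_finite_to_one D B phi"
proof -
  define L where "L x = fst (of_coords D B x)" for x
  define W where "W x = snd (of_coords D B x)" for x
  define g where "g x = det (edge_matrix D (W x ** adjugate (mat 1 - L x)))" for x
  \<comment> \<open>This point encodes \<open>L = 0\<close> and \<open>W = mat 1\<close>. It lies
    outside \<open>params D B\<close> as soon as \<open>D\<close> is nonempty, but \<open>g\<close>
    is a polynomial on the whole coordinate space, so one nonzero value anywhere suffices.\<close>
  define a :: "'n coord \<Rightarrow> real" where "a c = (case c of Diag i \<Rightarrow> 1 | _ \<Rightarrow> 0)" for c
  let ?C = "coords D B"
  have L: "coord_polynomial ?C (\<lambda>x. L x $ i $ j)" for i j
    by (cases "(i, j) \<in> D")
      (auto simp: L_def of_coords_def coords_def intro: coord_polynomial.intros)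
  have W: "coord_polynomial ?C (\<lambda>x. W x $ i $ j)" for i j
    by (cases "i = j"; cases "{i, j} \<in> B")
      (auto simp: W_def of_coords_def coords_def intro: coord_polynomial.intros)
  have "coord_polynomial ?C (\<lambda>x. (mat 1 - L x) $ i $ j)" for i j
    using coord_polynomial_diff[OF coord_polynomial.const L] by simp
  then have "coord_polynomial ?C g"
    unfolding g_def
    by (intro coord_polynomial_det_edge_matrix coord_polynomial_matrix_mult
        coord_polynomial_adjugate W)
  moreover have "g a \<noteq> 0"
  proof -
    have "L a = 0" "W a = mat 1"
      by (auto simp: L_def W_def a_def of_coords_def mat_def vec_eq_iff)
    moreover have "adjugate (mat 1) = (mat 1 :: real^'n^'n)"
      using matrix_inv_right_left(1)[of "mat 1 :: real^'n^'n"]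
      by (simp add: adjugate_eq invertible_det_nz)
    ultimately show ?thesis
      using simple_mixed_graphD(2)[OF assms] by (simp add: g_def edge_matrix_mat_1)
  qed
  moreover have "finite ?C" by (simp add: coords_def)
  ultimately have "AE x in Pi\<^sub>M ?C (\<lambda>_. lborel). g x \<noteq> 0"
    by (intro AE_coord_polynomial_nonzero)
  then show ?thesis
    unfolding generically_finite_to_one_def
  proof eventually_elim
    case (elim x)
    then show ?case
      using locally_injective_at_phi[OF assms, of "L x" "W x"] by (simp add: g_def L_def W_def)
  qed
qed

end
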